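(* Let $\lambda$ be a nonzero real number, $k\in\mathbb{Z}$, and let $Y$ be a random variable whose moment generating function $E[e^{Yt}]$ exists for $|t|<r$ for some $r>0$. For every positive integer $n$, $$\mathrm{Bel}_{n,\lambda}^{(k,Y)}(x)=\sum_{l=1}^{n}\frac{(1)_{l,\lambda}}{l^{k-1}}{n \brace l}_{Y,\lambda}x^{l}.$$
   Context: Degenerate falling factorial: $(x)_{0,\lambda}=1$, $(x)_{n,\lambda}=x(x-\lambda)\cdots(x-(n-1)\lambda)$ for $n\ge1$. Degenerate exponential: $e_\lambda^x(t)=(1+\lambda t)^{x/\lambda}=\sum_{n\ge0}(x)_{n,\lambda}\frac{t^n}{n!}$. For $k\in\mathbb{Z}$, $\mathrm{Ei}_{k,\lambda}(x)=\sum_{n=1}^{\infty}\frac{(1)_{n,\lambda}}{(n-1)!\,n^{k}}x^{n}$. The probabilistic degenerate poly-Bell polynomials $\mathrm{Bel}_{n,\lambda}^{(k,Y)}(x)$ are defined by $\mathrm{Ei}_{k,\lambda}\big(x(E[e_\lambda^Y(t)]-1)\big)=\sum_{n=1}^{\infty}\mathrm{Bel}_{n,\lambda}^{(k,Y)}(x)\frac{t^n}{n!}$ (power series in $t$), with $\mathrm{Bel}_{0,\lambda}^{(k,Y)}(x)=1$. The probabilistic degenerate Stirling numbers of the second kind are defined by $\frac{1}{k!}\big(E[e_\lambda^Y(t)]-1\big)^k=\sum_{n\ge k}{n \brace k}_{Y,\lambda}\frac{t^n}{n!}$ for $k\ge0$. *)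

theory Defs
  imports "HOL-Probability.Probability" "HOL-Complex_Analysis.Complex_Analysis"
begin

definition degen_ffact :: "real \<Rightarrow> real \<Rightarrow> nat \<Rightarrow> real" where
  "degen_ffact lam x n = (\<Prod>i<n. x - real i * lam)"

definition degen_exp :: "real \<Rightarrow> real \<Rightarrow> real \<Rightarrow> real" where
  "degen_exp lam x t = (1 + lam * t) powr (x / lam)"

text \<open>The summation index is shifted by one, so that the series starts at \<open>n = 1\<close>.\<close>

definition degen_Ei :: "int \<Rightarrow> real \<Rightarrow> real \<Rightarrow> real" where
  "degen_Ei k lam x =
     (\<Sum>n. degen_ffact lam 1 (Suc n) / (fact n * real (Suc n) powi k) * x ^ Suc n)"

text \<open>
  The coefficients \<open>a\<^sub>n\<close> determined by \<open>f t = (\<Sum>n. a\<^sub>n * t ^ n / n!)\<close> for all \<open>t\<close> near \<open>0\<close>.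
  Such an expansion is unique if it exists.
\<close>

definition egf_coeff :: "(real \<Rightarrow> real) \<Rightarrow> nat \<Rightarrow> real" where
  "egf_coeff f n = fact n * fps_nth (THE F. f has_fps_expansion F) n"

lemma has_fps_expansion_unique_real:
  fixes f :: "real \<Rightarrow> real"
  assumes "f has_fps_expansion F" and "f has_fps_expansion G"
  shows "F = G"
proof (rule ccontr)
  assume "F \<noteq> G"
  define D where "D = F - G"
  have "D \<noteq> 0" using \<open>F \<noteq> G\<close> by (simp add: D_def)
  have D: "(\<lambda>_. 0) has_fps_expansion D"
    using has_fps_expansion_diff[OF assms] by (simp add: D_def)
  obtain e where e: "e > 0" "\<And>t. \<bar>t\<bar> < e \<Longrightarrow> eval_fps D t = 0"
    using D unfolding has_fps_expansion_def eventually_nhds_metric by (auto simp: dist_norm)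
  obtain q where q: "q > 0" "ereal q < fps_conv_radius D"
    using D ereal_dense2[of 0 "fps_conv_radius D"] by (auto simp: has_fps_expansion_def)
  have sums: "(\<lambda>n. fps_nth D n * t ^ n) sums 0" if "norm t < min e q" for t
  proof -
    have "ereal (norm t) < fps_conv_radius D"
      using that q(2) by (meson ereal_less_le less_ereal.simps(1) less_imp_le min_less_iff_conj order_less_trans)
    hence "(\<lambda>n. fps_nth D n * t ^ n) sums eval_fps D t"
      by (intro sums_eval_fps) auto
    thus ?thesis using e(2)[of t] that by simp
  qed
  have D0: "fps_nth D 0 = 0"
    using sums[of 0] e(1) q(1) powser_sums_zero_iff[of "fps_nth D" 0] by simp
  obtain m where m: "fps_nth D m \<noteq> 0" using \<open>D \<noteq> 0\<close> by (auto simp: fps_eq_iff)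
  hence "m > 0" using D0 by (cases m) auto
  show False
  proof (rule powser_0_nonzero[of "min e q" 0 "fps_nth D" "\<lambda>_. 0" m])
    fix s :: real
    assume "s > 0" and "\<And>z::real. z \<in> cball 0 s - {0} \<Longrightarrow> (0::real) \<noteq> 0"
    from this(1) this(2)[of s] show False by auto
  qed (use e(1) q(1) sums m \<open>m > 0\<close> in auto)
qed

lemma egf_coeff_eqI:
  assumes "f has_fps_expansion F"
  shows "egf_coeff f n = fact n * fps_nth F n"
proof -
  have "(THE F. f has_fps_expansion F) = F"
    using assms has_fps_expansion_unique_real by blast
  thus ?thesis by (simp add: egf_coeff_def)
qed

definition expect_degen_exp :: "'a measure \<Rightarrow> ('a \<Rightarrow> real) \<Rightarrow> real \<Rightarrow> real \<Rightarrow> real" where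
  "expect_degen_exp M Y lam t = (LINT w|M. degen_exp lam (Y w) t)"

definition prob_degen_Stirling2 ::
    "'a measure \<Rightarrow> ('a \<Rightarrow> real) \<Rightarrow> real \<Rightarrow> nat \<Rightarrow> nat \<Rightarrow> real" where
  "prob_degen_Stirling2 M Y lam n k =
     egf_coeff (\<lambda>t. 1 / fact k * (expect_degen_exp M Y lam t - 1) ^ k) n"

text \<open>The value at \<open>n = 0\<close> is a convention: the generating function vanishes at \<open>t = 0\<close>.\<close>

definition prob_degen_poly_Bell ::
    "'a measure \<Rightarrow> ('a \<Rightarrow> real) \<Rightarrow> int \<Rightarrow> real \<Rightarrow> nat \<Rightarrow> real \<Rightarrow> real" where
  "prob_degen_poly_Bell M Y k lam n x =
     (if n = 0 then 1
      else egf_coeff (\<lambda>t. degen_Ei k lam (x * (expect_degen_exp M Y lam t - 1))) n)"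

end

theory Submission
  imports Defs
begin

text \<open>
  Expanding \<open>(1 + \<lambda>t)\<close> to the power \<open>Y/\<lambda>\<close> by the binomial series, its terms are dominated by those of
  \<open>(1 - \<bar>\<lambda>t\<bar>)\<close> to the power \<open>-\<bar>Y/\<lambda>\<bar>\<close>, which is \<open>exp (\<delta>\<bar>Y\<bar>)\<close> with \<open>\<delta> \<rightarrow> 0\<close> as \<open>t \<rightarrow> 0\<close> and hence
  integrable. So \<open>E[e\<^sub>\<lambda>\<^sup>Y(t)] - 1\<close> is given near \<open>0\<close> by a convergent power series \<open>B\<close> without constant
  term, and the theorem compares coefficients in the composition of \<open>Ei\<close> with \<open>x B\<close>.
\<close>

section \<open>Composition of real power series expansions\<close>

text \<open>Embedding the coefficients into the complex numbers makes composition of analytic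
  functions available, which yields a positive radius of convergence for the composed
  series.\<close>

definition fps_complex_of_real :: "real fps \<Rightarrow> complex fps" where
  "fps_complex_of_real F = Abs_fps (\<lambda>n. complex_of_real (fps_nth F n))"

lemma fps_nth_complex_of_real [simp]:
  "fps_nth (fps_complex_of_real F) n = complex_of_real (fps_nth F n)"
  by (simp add: fps_complex_of_real_def)

lemma fps_conv_radius_complex_of_real [simp]:
  "fps_conv_radius (fps_complex_of_real F) = fps_conv_radius F"
  by (simp add: fps_conv_radius_def conv_radius_def)

lemma eval_fps_complex_of_real:
  assumes "ereal \<bar>t\<bar> < fps_conv_radius F"
  shows "eval_fps (fps_complex_of_real F) (complex_of_real t) = complex_of_real (eval_fps F t)"
proof -
  have "(\<lambda>n. fps_nth F n * t ^ n) sums eval_fps F t"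
    using assms by (intro sums_eval_fps) auto
  hence "(\<lambda>n. complex_of_real (fps_nth F n * t ^ n)) sums complex_of_real (eval_fps F t)"
    by (rule sums_of_real)
  thus ?thesis
    by (simp add: eval_fps_def sums_iff)
qed

lemma fps_complex_of_real_power:
  "fps_complex_of_real (F ^ n) = fps_complex_of_real F ^ n"
proof (induction n)
  case 0
  show ?case by (simp add: fps_eq_iff)
next
  case (Suc n)
  show ?case by (simp add: fps_eq_iff fps_mult_nth flip: Suc.IH)
qed

lemma fps_complex_of_real_compose:
  "fps_complex_of_real (fps_compose F G) =
     fps_compose (fps_complex_of_real F) (fps_complex_of_real G)"
  by (simp add: fps_eq_iff fps_compose_nth flip: fps_complex_of_real_power)

lemma eventually_less_fps_conv_radius:
  assumes "fps_conv_radius F > 0"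
  shows "eventually (\<lambda>t::real. ereal \<bar>t\<bar> < fps_conv_radius F) (nhds 0)"
proof -
  obtain q where q: "q > 0" "ereal q < fps_conv_radius F"
    using assms ereal_dense2[of 0 "fps_conv_radius F"] by auto
  have "eventually (\<lambda>t::real. \<bar>t\<bar> < q) (nhds 0)"
    using q(1) by (auto simp: eventually_nhds_metric dist_norm)
  thus ?thesis
  proof eventually_elim
    case (elim t)
    thus ?case using q(2) by (meson ereal_less_le less_ereal.simps(1) less_imp_le order.strict_trans)
  qed
qed

text \<open>The complex extensions of both series compose near 0; restricting that identity to the
  real axis gives the claim.\<close>

lemma has_fps_expansion_compose_real:
  fixes f g :: "real \<Rightarrow> real"
  assumes F: "f has_fps_expansion F"
    and G: "g has_fps_expansion G" "fps_nth G 0 = 0"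
  shows "(\<lambda>t. f (g t)) has_fps_expansion fps_compose F G"
proof -
  let ?F = "fps_complex_of_real F" and ?G = "fps_complex_of_real G"
  have rad: "fps_conv_radius F > 0" "fps_conv_radius G > 0"
    using F G by (auto simp: has_fps_expansion_def)
  have "(eval_fps ?F \<circ> eval_fps ?G) has_fps_expansion fps_compose ?F ?G"
    using rad G(2) by (intro has_fps_expansion_compose eval_fps_has_fps_expansion) auto
  hence *: "(eval_fps ?F \<circ> eval_fps ?G) has_fps_expansion fps_complex_of_real (fps_compose F G)"
    by (simp add: fps_complex_of_real_compose)
  hence rad': "fps_conv_radius (fps_compose F G) > 0"
    by (simp add: has_fps_expansion_def)
  have "eventually (\<lambda>z. eval_fps (fps_complex_of_real (fps_compose F G)) z =
          eval_fps ?F (eval_fps ?G z)) (nhds 0)"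
    using * by (simp add: has_fps_expansion_def)
  moreover have "filterlim complex_of_real (nhds 0) (nhds 0)"
    using tendsto_of_real[of "\<lambda>t::real. t" 0 "nhds 0", OF filterlim_ident] by simp
  ultimately have ev: "eventually (\<lambda>t. eval_fps (fps_complex_of_real (fps_compose F G)) (complex_of_real t)
          = eval_fps ?F (eval_fps ?G (complex_of_real t))) (nhds 0)"
    by (rule eventually_compose_filterlim)
  have "g 0 = 0"
    using has_fps_expansion_imp_0_eq_fps_nth_0[OF G(1)] G(2) by simp
  moreover have "isCont g 0"
    using has_fps_expansion_imp_continuous[OF G(1)] by simp
  ultimately have lim: "filterlim g (nhds 0) (nhds 0)"
    using tendsto_nhds_iff[of g]
    by (simp add: isCont_def)
  have "eventually (\<lambda>t. eval_fps F (g t) = f (g t)) (nhds 0)"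
    using F by (intro eventually_compose_filterlim[OF _ lim]) (simp add: has_fps_expansion_def)
  moreover have "eventually (\<lambda>t. eval_fps G t = g t) (nhds 0)"
    using G by (simp add: has_fps_expansion_def)
  \<comment> \<open>The point \<open>g t\<close> has to lie in the disc of convergence of
    \<open>F\<close>, so that the complex series there takes the embedded real value.\<close>
  moreover have "eventually (\<lambda>t. ereal \<bar>g t\<bar> < fps_conv_radius F) (nhds 0)"
    by (intro eventually_compose_filterlim[OF _ lim] eventually_less_fps_conv_radius rad)
  ultimately have "eventually (\<lambda>t. eval_fps (fps_compose F G) t = f (g t)) (nhds 0)"
    using ev eventually_less_fps_conv_radius[OF rad(2)] eventually_less_fps_conv_radius[OF rad']
    by eventually_elim (simp add: eval_fps_complex_of_real)
  thus ?thesis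
    using rad' by (simp add: has_fps_expansion_def)
qed

section \<open>The binomial series of a random exponent\<close>

text \<open>Each factor satisfies |a - i| <= |a| + i, and pulling a sign out of all n factors |a| +
  i turns their product into the one for -|a|.\<close>

lemma abs_gchoose_le:
  fixes a :: real
  shows "\<bar>a gchoose n\<bar> \<le> (-1) ^ n * (-\<bar>a\<bar> gchoose n)"
proof -
  have "\<bar>\<Prod>i = 0..<n. a - of_nat i\<bar> \<le> (\<Prod>i = 0..<n. \<bar>a\<bar> + of_nat i)"
    unfolding abs_prod by (intro prod_mono) auto
  also have "\<dots> = (\<Prod>i = 0..<n. (-1) * (-\<bar>a\<bar> - of_nat i))"
    by (intro prod.cong) auto
  also have "\<dots> = (-1) ^ n * (\<Prod>i = 0..<n. -\<bar>a\<bar> - of_nat i)"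
    by (subst prod.distrib) simp
  finally show ?thesis
    by (simp add: gbinomial_prod_rev divide_right_mono abs_divide)
qed

lemma neg_binomial_series_abs:
  fixes a s :: real
  assumes "\<bar>s\<bar> < 1"
  shows "(\<lambda>n. (-1) ^ n * (-\<bar>a\<bar> gchoose n) * \<bar>s\<bar> ^ n) sums ((1 - \<bar>s\<bar>) powr (-\<bar>a\<bar>))"
proof -
  have "(\<lambda>n. (-\<bar>a\<bar> gchoose n) * (-\<bar>s\<bar>) ^ n) sums ((1 + (-\<bar>s\<bar>)) powr (-\<bar>a\<bar>))"
    using assms by (intro gen_binomial_real) auto
  moreover have "(-\<bar>a\<bar> gchoose n) * (-\<bar>s\<bar>) ^ n = (-1) ^ n * (-\<bar>a\<bar> gchoose n) * \<bar>s\<bar> ^ n" for n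
    by (subst power_minus) simp
  ultimately show ?thesis by simp
qed

text \<open>The majorant series has nonnegative terms, so its partial sums stay below its full sum.
  As the bound is independent of \<open>n\<close>, it gives absolute summability and, for a random
  exponent, a dominating function.\<close>

lemma sum_abs_gchoose_le:
  fixes a s :: real
  assumes "\<bar>s\<bar> < 1"
  shows "(\<Sum>i<n. \<bar>(a gchoose i) * s ^ i\<bar>) \<le> (1 - \<bar>s\<bar>) powr (-\<bar>a\<bar>)"
proof -
  have "(\<Sum>i<n. \<bar>(a gchoose i) * s ^ i\<bar>) \<le> (\<Sum>i<n. (-1) ^ i * (-\<bar>a\<bar> gchoose i) * \<bar>s\<bar> ^ i)"
    unfolding abs_mult power_abs by (intro sum_mono mult_right_mono abs_gchoose_le) auto
  also have "\<dots> \<le> (1 - \<bar>s\<bar>) powr (-\<bar>a\<bar>)"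
    using neg_binomial_series_abs[OF assms, of a]
    by (intro sum_le_suminf[of _ "{..<n}", THEN order_trans])
       (auto simp: sums_iff intro!: mult_nonneg_nonneg order_trans[OF abs_ge_zero abs_gchoose_le])
  finally show ?thesis .
qed

lemma summable_abs_gchoose:
  fixes a s :: real
  assumes "\<bar>s\<bar> < 1"
  shows "summable (\<lambda>n. \<bar>(a gchoose n) * s ^ n\<bar>)"
  using sum_abs_gchoose_le[OF assms] by (intro summableI_nonneg_bounded) auto

context prob_space
begin

text \<open>The integrand equals exp(Y \<delta>) or exp(-Y \<delta>) according to the sign of Y, so
  the sum of both, integrable by the moment hypothesis at \<delta> and -\<delta>, dominates
  it.\<close>

lemma integrable_exp_abs:
  fixes Y :: "'a \<Rightarrow> real"
  assumes [measurable]: "Y \<in> borel_measurable M"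
    and mgf: "\<And>t. \<bar>t\<bar> < r \<Longrightarrow> integrable M (\<lambda>w. exp (Y w * t))"
    and \<delta>: "\<bar>\<delta>\<bar> < r"
  shows "integrable M (\<lambda>w. exp (\<bar>Y w\<bar> * \<delta>))"
proof (rule Bochner_Integration.integrable_bound)
  show "integrable M (\<lambda>w. exp (Y w * \<delta>) + exp (Y w * (-\<delta>)))"
    using \<delta> by (intro Bochner_Integration.integrable_add mgf) auto
  have "exp (\<bar>Y w\<bar> * \<delta>) \<le> exp (Y w * \<delta>) + exp (Y w * (-\<delta>))" for w
    by (cases "Y w \<ge> 0") auto
  thus "AE w in M. norm (exp (\<bar>Y w\<bar> * \<delta>)) \<le> norm (exp (Y w * \<delta>) + exp (Y w * (-\<delta>)))"
    by (auto intro: order_trans abs_ge_self)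
qed auto

text \<open>The binomial series of (1 + lam t)^(Y/lam) is integrated term by term, the sums of the
  absolute values of its terms having an integrable bound.\<close>

lemma expectation_gchoose_sums:
  fixes Y :: "'a \<Rightarrow> real"
  assumes lam: "lam \<noteq> 0"
    and Y [measurable]: "Y \<in> borel_measurable M"
    and mgf: "\<And>t. \<bar>t\<bar> < r \<Longrightarrow> integrable M (\<lambda>w. exp (Y w * t))"
    and t: "\<bar>lam * t\<bar> < 1" "\<bar>ln (1 - \<bar>lam * t\<bar>) / lam\<bar> < r"
  shows "(\<lambda>n. expectation (\<lambda>w. (Y w / lam gchoose n) * lam ^ n) * t ^ n) sums
           expect_degen_exp M Y lam t"
proof -
  \<comment> \<open>This is exp(\<delta> |Y|) with \<delta> = -ln(1 - |lam t|) / |lam|; the second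
    assumption in \<open>t\<close> says precisely that |\<delta>| < r.\<close>
  define D where "D w = (1 - \<bar>lam * t\<bar>) powr (-\<bar>Y w / lam\<bar>)" for w
  define f where "f i w = (Y w / lam gchoose i) * (lam * t) ^ i" for i w
  have "D = (\<lambda>w. exp (\<bar>Y w\<bar> * - (ln (1 - \<bar>lam * t\<bar>) / \<bar>lam\<bar>)))"
    using t(1) by (auto simp: fun_eq_iff D_def powr_def abs_divide)
  moreover have "\<bar>- (ln (1 - \<bar>lam * t\<bar>) / \<bar>lam\<bar>)\<bar> < r"
    using t(2) by (simp add: abs_divide)
  ultimately have D: "integrable M D"
    using integrable_exp_abs[OF Y mgf, of r] by metis
  have [measurable]: "f i \<in> borel_measurable M" for i
    unfolding f_def gbinomial_prod_rev by measurable
  have sum_le: "(\<Sum>i<n. \<bar>f i w\<bar>) \<le> D w" for n w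
    unfolding f_def D_def by (rule sum_abs_gchoose_le[OF t(1)])
  have int: "integrable M (f i)" for i
  proof (rule Bochner_Integration.integrable_bound[OF D])
    have "\<bar>f i w\<bar> \<le> D w" for w
    proof -
      have "\<bar>f i w\<bar> \<le> (\<Sum>j<Suc i. \<bar>f j w\<bar>)"
        by (simp add: sum_nonneg)
      also have "\<dots> \<le> D w" by (rule sum_le)
      finally show ?thesis .
    qed
    thus "AE w in M. norm (f i w) \<le> norm (D w)"
      by (auto intro: order_trans abs_ge_self)
  qed auto
  have "(\<lambda>i. integral\<^sup>L M (f i)) sums (\<integral>w. (\<Sum>i. f i w) \<partial>M)"
  proof (rule sums_integral[OF int])
    show "AE w in M. summable (\<lambda>i. norm (f i w))"
      using summable_abs_gchoose[OF t(1)] by (simp add: f_def)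
    show "summable (\<lambda>i. \<integral>w. norm (f i w) \<partial>M)"
    proof (rule summableI_nonneg_bounded)
      fix n
      have "(\<Sum>i<n. \<integral>w. norm (f i w) \<partial>M) = (\<integral>w. (\<Sum>i<n. \<bar>f i w\<bar>) \<partial>M)"
        using int by (subst Bochner_Integration.integral_sum) auto
      also have "\<dots> \<le> integral\<^sup>L M D"
        using int D sum_le by (intro integral_mono) auto
      finally show "(\<Sum>i<n. \<integral>w. norm (f i w) \<partial>M) \<le> integral\<^sup>L M D" .
    qed auto
  qed
  moreover have "(\<Sum>i. f i w) = degen_exp lam (Y w) t" for w
    using gen_binomial_real[OF t(1), of "Y w / lam"]
    by (simp add: f_def degen_exp_def sums_iff)
  moreover have "integral\<^sup>L M (f i) = expectation (\<lambda>w. (Y w / lam gchoose i) * lam ^ i) * t ^ i" for i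
    by (simp add: f_def[abs_def] power_mult_distrib flip: mult.assoc)
  ultimately show ?thesis
    by (simp add: expect_degen_exp_def)
qed

text \<open>Both smallness conditions for the termwise expectation hold near 0, since their
  left-hand sides are continuous at 0 and vanish there. The n-th coefficient is the expectation of
  the degenerate falling factorial of Y, divided by n!.\<close>

lemma expect_degen_exp_has_fps_expansion:
  fixes Y :: "'a \<Rightarrow> real"
  assumes lam: "lam \<noteq> 0"
    and Y: "Y \<in> borel_measurable M"
    and r: "r > 0"
    and mgf: "\<And>t. \<bar>t\<bar> < r \<Longrightarrow> integrable M (\<lambda>w. exp (Y w * t))"
  shows "expect_degen_exp M Y lam has_fps_expansion
           Abs_fps (\<lambda>n. expectation (\<lambda>w. (Y w / lam gchoose n) * lam ^ n))"
proof (rule has_fps_expansionI)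
  have "((\<lambda>t. \<bar>lam * t\<bar>) \<longlongrightarrow> \<bar>lam * 0\<bar>) (nhds 0)"
    by (intro tendsto_intros filterlim_ident)
  hence "eventually (\<lambda>t. \<bar>lam * t\<bar> < 1) (nhds 0)"
    by (rule order_tendstoD) auto
  moreover have "((\<lambda>t. \<bar>ln (1 - \<bar>lam * t\<bar>) / lam\<bar>) \<longlongrightarrow> \<bar>ln (1 - \<bar>lam * 0\<bar>) / lam\<bar>) (nhds 0)"
    using lam by (intro tendsto_intros filterlim_ident) auto
  hence "eventually (\<lambda>t. \<bar>ln (1 - \<bar>lam * t\<bar>) / lam\<bar> < r) (nhds 0)"
    by (rule order_tendstoD) (use r in auto)
  ultimately show "eventually (\<lambda>t. (\<lambda>n. fps_nth (Abs_fps (\<lambda>n. expectation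
      (\<lambda>w. (Y w / lam gchoose n) * lam ^ n))) n * t ^ n) sums expect_degen_exp M Y lam t) (nhds 0)"
    unfolding fps_nth_Abs_fps by eventually_elim (rule expectation_gchoose_sums[OF lam Y mgf])
qed

end

section \<open>The degenerate exponential integral\<close>

lemma degen_ffact_eq_gchoose:
  assumes "lam \<noteq> 0"
  shows "degen_ffact lam x n = fact n * (x / lam gchoose n) * lam ^ n"
proof -
  have "degen_ffact lam x n = (\<Prod>i<n. (x / lam - real i) * lam)"
    using assms unfolding degen_ffact_def by (intro prod.cong) (auto simp: field_simps)
  also have "\<dots> = (\<Prod>i<n. x / lam - real i) * lam ^ n"
    by (subst prod.distrib) simp
  finally show ?thesis
    by (simp add: gbinomial_prod_rev atLeast0LessThan)
qed

text \<open>Since (n-1)! n^k = n! n^(k-1) for positive n, this is the coefficient of Ei in the shape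
  wanted for the final comparison. For n = 0 and k = 1 its value is 1 although Ei has no constant
  term, so the series treats n = 0 separately.\<close>

definition degen_Ei_coeff :: "int \<Rightarrow> real \<Rightarrow> nat \<Rightarrow> real" where
  "degen_Ei_coeff k lam n = degen_ffact lam 1 n / real n powi (k - 1) / fact n"

lemma degen_Ei_coeff_Suc:
  "degen_Ei_coeff k lam (Suc n) = degen_ffact lam 1 (Suc n) / (fact n * real (Suc n) powi k)"
proof -
  have "real (Suc n) powi k = real (Suc n) powi (k - 1) * real (Suc n)"
    using power_int_add_1[of "real (Suc n)" "k - 1"] by simp
  thus ?thesis
    by (simp add: degen_Ei_coeff_def mult_ac del: of_nat_Suc)
qed

text \<open>This crude bound follows from n < 2^n. An exponential bound suffices because it only
  rescales the radius of convergence.\<close>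

lemma power_int_le_exponential:
  assumes "n > 0"
  shows "real n powi j \<le> (2 ^ nat \<bar>j\<bar>) ^ n"
proof -
  have "real n powi j \<le> real n powi int (nat \<bar>j\<bar>)"
    using assms by (intro power_int_increasing) auto
  also have "\<dots> = real n ^ nat \<bar>j\<bar>"
    by (rule power_int_of_nat)
  also have "\<dots> \<le> (2 ^ n) ^ nat \<bar>j\<bar>"
    by (intro power_mono) (auto simp: less_imp_le)
  finally show ?thesis
    by (simp add: mult.commute flip: power_mult)
qed

lemma degen_Ei_has_fps_expansion:
  assumes lam: "lam \<noteq> 0"
  shows "degen_Ei k lam has_fps_expansion
           Abs_fps (\<lambda>n. if n = 0 then 0 else degen_Ei_coeff k lam n)" (is "_ has_fps_expansion ?A")
proof (rule has_fps_expansionI)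
  \<comment> \<open>The factor n^(1-k) of the coefficients is at most C^n, which leaves a comparison
    with the binomial series of exponent 1/lam at lam C t.\<close>
  define C :: real where "C = 2 ^ nat \<bar>1 - k\<bar>"
  have C: "C > 0" by (simp add: C_def)
  have "((\<lambda>t. \<bar>lam * C * t\<bar>) \<longlongrightarrow> \<bar>lam * C * 0\<bar>) (nhds 0)"
    by (intro tendsto_intros filterlim_ident)
  hence "eventually (\<lambda>t. \<bar>lam * C * t\<bar> < 1) (nhds 0)"
    by (rule order_tendstoD) auto
  thus "eventually (\<lambda>t. (\<lambda>n. fps_nth ?A n * t ^ n) sums degen_Ei k lam t) (nhds 0)"
  proof eventually_elim
    case (elim t)
    have "norm (fps_nth ?A n * t ^ n) \<le> \<bar>(1 / lam gchoose n) * (lam * C * t) ^ n\<bar>" for n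
    proof (cases "n = 0")
      case False
      have "degen_Ei_coeff k lam n = (1 / lam gchoose n) * lam ^ n * real n powi (1 - k)"
        using power_int_minus_divide[of "real n" "k - 1"]
        by (simp add: degen_Ei_coeff_def degen_ffact_eq_gchoose[OF lam])
      hence "norm (fps_nth ?A n * t ^ n) =
               \<bar>1 / lam gchoose n\<bar> * \<bar>lam\<bar> ^ n * \<bar>t\<bar> ^ n * real n powi (1 - k)"
        using False by (simp add: abs_mult power_abs power_int_abs)
      also have "\<dots> \<le> \<bar>1 / lam gchoose n\<bar> * \<bar>lam\<bar> ^ n * \<bar>t\<bar> ^ n * C ^ n"
        unfolding C_def using False by (intro mult_left_mono power_int_le_exponential) auto
      finally show ?thesis
        using C by (simp add: abs_mult power_abs power_mult_distrib mult_ac)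
    qed auto
    hence "summable (\<lambda>n. fps_nth ?A n * t ^ n)"
      using summable_abs_gchoose[OF elim, of "1 / lam"] by (rule summable_comparison_test'[rotated])
    \<comment> \<open>The series in \<open>degen_Ei\<close> is shifted by one; dropping the zeroth
      term changes nothing because that coefficient is 0.\<close>
    hence "(\<lambda>n. fps_nth ?A (Suc n) * t ^ Suc n) sums ((\<Sum>n. fps_nth ?A n * t ^ n) - fps_nth ?A 0 * t ^ 0)"
      by (subst sums_Suc_iff) (simp add: summable_sums)
    moreover have "degen_Ei k lam t = (\<Sum>n. fps_nth ?A (Suc n) * t ^ Suc n)"
      by (simp add: degen_Ei_def degen_Ei_coeff_Suc del: of_nat_Suc power_Suc)
    ultimately show ?case
      using \<open>summable (\<lambda>n. fps_nth ?A n * t ^ n)\<close> by (simp add: sums_iff)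
  qed
qed

section \<open>Coefficient comparison\<close>

theorem theorem2p2:
  fixes M :: "'a measure" and Y :: "'a \<Rightarrow> real" and lam x r :: real and k :: int and n :: nat
  assumes "lam \<noteq> 0"
    and "prob_space M"
    and "Y \<in> borel_measurable M"
    and "r > 0"
    and "\<And>t. \<bar>t\<bar> < r \<Longrightarrow> integrable M (\<lambda>w. exp (Y w * t))"
    and "n \<ge> 1"
  shows "prob_degen_poly_Bell M Y k lam n x =
    (\<Sum>l=1..n. degen_ffact lam 1 l / real l powi (k - 1) * prob_degen_Stirling2 M Y lam n l * x ^ l)"
proof -
  interpret prob_space M by fact
  define A where "A = Abs_fps (\<lambda>n. if n = 0 then 0 else degen_Ei_coeff k lam n)"
  define B where "B = Abs_fps (\<lambda>n. expectation (\<lambda>w. (Y w / lam gchoose n) * lam ^ n)) - 1"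
  have B: "(\<lambda>t. expect_degen_exp M Y lam t - 1) has_fps_expansion B"
    unfolding B_def using assms
    by (intro has_fps_expansion_diff has_fps_expansion_1 expect_degen_exp_has_fps_expansion)
  \<comment> \<open>The constant term is E[1] - 1, which is 0 because \<open>M\<close> has total
    mass 1. This permits substituting into \<open>A\<close>.\<close>
  have "fps_nth B 0 = 0"
    by (simp add: B_def prob_space)
  have Stirling: "prob_degen_Stirling2 M Y lam n l = fact n / fact l * fps_nth (B ^ l) n" for l
  proof -
    have "(\<lambda>t. 1 / fact l * (expect_degen_exp M Y lam t - 1) ^ l) has_fps_expansion
            fps_const (1 / fact l) * B ^ l"
      by (intro has_fps_expansion_cmult_left has_fps_expansion_power B)
    thus ?thesis
      unfolding prob_degen_Stirling2_def by (subst egf_coeff_eqI) auto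
  qed
  have "(\<lambda>t. degen_Ei k lam (x * (expect_degen_exp M Y lam t - 1))) has_fps_expansion
          fps_compose A (fps_const x * B)"
    unfolding A_def using assms \<open>fps_nth B 0 = 0\<close>
    by (intro has_fps_expansion_compose_real degen_Ei_has_fps_expansion
          has_fps_expansion_cmult_left B) auto
  hence "prob_degen_poly_Bell M Y k lam n x = fact n * fps_nth (fps_compose A (fps_const x * B)) n"
    using \<open>n \<ge> 1\<close> unfolding prob_degen_poly_Bell_def by (simp add: egf_coeff_eqI)
  also have "\<dots> = (\<Sum>l=0..n. fact n * (fps_nth A l * (x ^ l * fps_nth (B ^ l) n)))"
    by (simp add: fps_compose_nth power_mult_distrib fps_const_power sum_distrib_left)
  \<comment> \<open>The term for l = 0 drops out since \<open>A\<close> has no constant term. In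
    what remains, the 1/l! in the coefficient of \<open>A\<close> is the one in the formula
    \<open>Stirling\<close>.\<close>
  also have "\<dots> = (\<Sum>l=1..n. fact n * (fps_nth A l * (x ^ l * fps_nth (B ^ l) n)))"
    by (rule sum.mono_neutral_right) (auto simp: A_def)
  also have "\<dots> = (\<Sum>l=1..n. degen_ffact lam 1 l / real l powi (k - 1) *
                     prob_degen_Stirling2 M Y lam n l * x ^ l)"
    by (intro sum.cong) (auto simp: A_def degen_Ei_coeff_def Stirling)
  finally show ?thesis .
qed

end
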